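(* Let $G(n,n_1,n_2,p_1,p_2)$ be a two-layer stochastic block model network. Let $\{l,k\}=\{1,2\}$, and let $Q_l$ and $Q'_l$ be the modularity of layer $l$ before and after applying RemoveEdge to all communities of the other layer $k$. Then $Q'_l>Q_l$. That is, the modularity of a layer increases if RemoveEdge is applied on the communities of the other layer.
   Context: Two-layer stochastic block model $G(n,n_1,n_2,p_1,p_2)$: $n,n_1,n_2$ are positive integers with $n_1,n_2\ge 3$, and $p_1,p_2\in(0,1]$. For $l=1,2$, layer $l$ is a partition of the $n$ nodes into $n_l$ communities, each of size $s_l=n/n_l$. The two layers are independent of each other, so that each community of layer 1 and each community of layer 2 have $r=n/(n_1n_2)$ nodes in common; $s_1,s_2,r$ are treated as integers and the intersection sizes as exactly $r$. A node pair is internal to layer $l$ if both nodes lie in the same community of layer $l$. Independently for each pair, a pair internal only to layer 1 forms an edge with probability $p_1$, a pair internal only to layer 2 with probability $p_2$, a pair internal to both layers with probability $p_{12}=p_1+p_2-p_1p_2$, and a pair internal to neither layer never forms an edge. Self-loops are allowed and pairs are counted so that a set of $s$ nodes contains $\tfrac12 s^2$ node pairs. All edge counts are expected numbers. For layer $l$, $e_{ll}$ is the expected number of edges internal to one community of layer $l$, $e_{lout}$ is the expected number of edges with exactly one endpoint in that community (these numbers are the same for all communities of the layer), and $d_l=2e_{ll}+e_{lout}$. The total number of edges is $e=\tfrac12 n_l d_l$. The modularity of layer $l$ is $Q_l=\sum_{i}\left[\frac{e_{ll}}{e}-\left(\frac{d_l}{2e}\right)^2\right]$, the sum being over the $n_l$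 communities $i$ of layer $l$. After an operation on the network, modularity is given by the same formula with the (expected) edge counts of the modified network. RemoveEdge on layer $k$: delete from the network all edges internal to layer $k$ (all edges whose two endpoints lie in a common community of layer $k$), and leave all other edges unchanged. *)

theory Defs
  imports "HOL-Probability.Probability" "HOL-Library.Disjoint_Sets"
begin

text \<open>
  Node pairs and edges are sets \<open>{u, v}\<close> of nodes, a self-loop at \<open>u\<close> being the singleton
  \<open>{u}\<close>; a layer is the set of its communities; a network is a probability distribution
  over edge sets.
\<close>

definition node_pairs :: "'v set \<Rightarrow> 'v set set" where
  "node_pairs V = {{u, v} | u v. u \<in> V \<and> v \<in> V}"

definition internal :: "'v set set \<Rightarrow> 'v set \<Rightarrow> bool" where
  "internal P e \<longleftrightarrow> (\<exists>C\<in>P. e \<subseteq> C)"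

locale two_layer_sbm =
  fixes V :: "'v set" and L :: "nat \<Rightarrow> 'v set set"
    and n n1 n2 :: nat and p1 p2 :: real
  assumes finite_V: "finite V"
    and card_V: "card V = n"
    and n_pos: "n > 0"
    and n1_ge_3: "n1 \<ge> 3"
    and n2_ge_3: "n2 \<ge> 3"
    and divides: "n1 * n2 dvd n"
    and p1: "0 < p1" "p1 \<le> 1"
    and p2: "0 < p2" "p2 \<le> 1"
    and partition1: "partition_on V (L 1)"
    and partition2: "partition_on V (L 2)"
    and card_layer1: "card (L 1) = n1"
    and card_layer2: "card (L 2) = n2"
    and community_size1: "\<And>C. C \<in> L 1 \<Longrightarrow> card C = n div n1"
    and community_size2: "\<And>D. D \<in> L 2 \<Longrightarrow> card D = n div n2"
    and intersection_size: "\<And>C D. C \<in> L 1 \<Longrightarrow> D \<in> L 2 \<Longrightarrow> card (C \<inter> D) = n div (n1 * n2)"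

definition edge_prob :: "(nat \<Rightarrow> 'v set set) \<Rightarrow> real \<Rightarrow> real \<Rightarrow> 'v set \<Rightarrow> real" where
  "edge_prob L p1 p2 e =
     (if internal (L 1) e \<and> internal (L 2) e then p1 + p2 - p1 * p2
      else if internal (L 1) e then p1
      else if internal (L 2) e then p2
      else 0)"

definition sbm_network ::
  "'v set \<Rightarrow> (nat \<Rightarrow> 'v set set) \<Rightarrow> real \<Rightarrow> real \<Rightarrow> 'v set set pmf" where
  "sbm_network V L p1 p2 =
     map_pmf (\<lambda>f. {e \<in> node_pairs V. f e})
       (Pi_pmf (node_pairs V) False (\<lambda>e. bernoulli_pmf (edge_prob L p1 p2 e)))"

text \<open>
  Self-loops count one half: then a set of \<open>s\<close> nodes contains
  \<open>s * (s - 1) / 2 + s / 2 = s^2 / 2\<close> node pairs.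
\<close>

definition edge_count :: "'v set set \<Rightarrow> real" where
  "edge_count E = (\<Sum>e\<in>E. if card e = 1 then 1 / 2 else 1)"

definition expected_edges :: "'v set set pmf \<Rightarrow> ('v set \<Rightarrow> bool) \<Rightarrow> real" where
  "expected_edges G X = measure_pmf.expectation G (\<lambda>E. edge_count {e \<in> E. X e})"

definition edges_in :: "'v set set pmf \<Rightarrow> 'v set \<Rightarrow> real" where
  "edges_in G C = expected_edges G (\<lambda>e. e \<subseteq> C)"

definition edges_out :: "'v set set pmf \<Rightarrow> 'v set \<Rightarrow> real" where
  "edges_out G C = expected_edges G (\<lambda>e. e \<inter> C \<noteq> {} \<and> \<not> e \<subseteq> C)"

definition community_degree :: "'v set set pmf \<Rightarrow> 'v set \<Rightarrow> real" where
  "community_degree G C = 2 * edges_in G C + edges_out G C"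

definition edges_total :: "'v set set pmf \<Rightarrow> real" where
  "edges_total G = expected_edges G (\<lambda>e. True)"

definition modularity :: "'v set set pmf \<Rightarrow> 'v set set \<Rightarrow> real" where
  "modularity G P =
     (\<Sum>C\<in>P. edges_in G C / edges_total G - (community_degree G C / (2 * edges_total G))\<^sup>2)"

definition remove_edge :: "'v set set \<Rightarrow> 'v set set \<Rightarrow> 'v set set" where
  "remove_edge P E = {e \<in> E. \<not> internal P e}"

end

theory Submission
  imports Defs
begin

text \<open>
  The degrees of the communities of a layer add up to twice the number \<open>e\<close> of edges, so by
  Cauchy-Schwarz the modularity of a layer with \<open>m\<close> communities is at most
  (fraction of internal edges) \<open>- 1 / m\<close>. Before RemoveEdge this is less than \<open>1 - 1 / m\<close>, because
  some edges are internal to layer \<open>k\<close> only. After RemoveEdge every remaining edge is internal to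
  layer \<open>l\<close>, and these edges are distributed evenly over its communities, so the modularity equals
  \<open>1 - 1 / m\<close>.
\<close>

section \<open>Expected edge counts as double sums over nodes\<close>

text \<open>A pair of distinct nodes comes from two ordered pairs, a self-loop from one. The weight
  1/2 of a self-loop therefore makes every weight half the number of ordered pairs above it.\<close>

lemma sum_node_pairs:
  fixes g :: "'v set \<Rightarrow> real"
  assumes "finite V"
  shows "(\<Sum>e\<in>node_pairs V. (if card e = 1 then 1 / 2 else 1) * g e) = (\<Sum>u\<in>V. \<Sum>v\<in>V. g {u, v}) / 2"
proof -
  let ?h = "\<lambda>(u, v). {u, v}"
  have np: "node_pairs V = ?h ` (V \<times> V)"
    by (auto simp: node_pairs_def)
  have fibre: "real (card {x \<in> V \<times> V. ?h x = e}) = 2 * (if card e = 1 then 1 / 2 else 1)"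
    if "e \<in> node_pairs V" for e
  proof -
    from that obtain u v where e: "e = {u, v}" "u \<in> V" "v \<in> V"
      by (auto simp: node_pairs_def)
    have "{x \<in> V \<times> V. ?h x = e} = {(u, v), (v, u)}"
      unfolding e(1) using e(2,3) by (auto dest: doubleton_eq_iff[THEN iffD1])
    with e(1) show ?thesis
      by (cases "u = v") auto
  qed
  have "(\<Sum>u\<in>V. \<Sum>v\<in>V. g {u, v}) = (\<Sum>x\<in>V \<times> V. g (?h x))"
    by (simp add: sum.cartesian_product case_prod_unfold)
  also have "\<dots> = (\<Sum>e\<in>node_pairs V. \<Sum>x\<in>{x \<in> V \<times> V. ?h x = e}. g (?h x))"
    using assms by (subst sum.group) (auto simp: np)
  also have "\<dots> = (\<Sum>e\<in>node_pairs V. real (card {x \<in> V \<times> V. ?h x = e}) * g e)"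
    by (intro sum.cong refl) auto
  also have "\<dots> = 2 * (\<Sum>e\<in>node_pairs V. (if card e = 1 then 1 / 2 else 1) * g e)"
    by (simp only: sum_distrib_left mult.assoc[symmetric] fibre cong: sum.cong)
  finally show ?thesis
    by simp
qed

lemma edge_prob_bounds:
  assumes p: "0 \<le> p1" "p1 \<le> 1" "0 \<le> p2" "p2 \<le> 1"
  shows "0 \<le> edge_prob L p1 p2 e" "edge_prob L p1 p2 e \<le> 1"
proof -
  \<comment> \<open>With \<open>p12 = p1 + p2 - p1 * p2\<close>, the first product is
    \<open>1 - p12\<close> and the second expression is \<open>p12\<close>.\<close>
  have "0 \<le> (1 - p1) * (1 - p2)" "0 \<le> p1 + p2 * (1 - p1)"
    using p by simp_all
  then have "p1 + p2 - p1 * p2 \<le> 1" "0 \<le> p1 + p2 - p1 * p2"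
    by (simp_all add: algebra_simps)
  with p show "0 \<le> edge_prob L p1 p2 e" "edge_prob L p1 p2 e \<le> 1"
    by (simp_all only: edge_prob_def split: if_split) auto
qed

text \<open>Linearity of expectation: a pair contributes its weight times its marginal edge
  probability. From here on the network enters only through such double sums.\<close>

lemma expected_edges_sbm_network:
  assumes V: "finite V" and p: "0 \<le> p1" "p1 \<le> 1" "0 \<le> p2" "p2 \<le> 1"
  shows "expected_edges (sbm_network V L p1 p2) X =
    (\<Sum>u\<in>V. \<Sum>v\<in>V. of_bool (X {u, v}) * edge_prob L p1 p2 {u, v}) / 2"
proof -
  let ?N = "node_pairs V" and ?q = "edge_prob L p1 p2"
  let ?w = "\<lambda>e::'a set. (if card e = 1 then 1 / 2 else 1) :: real"
  let ?M = "Pi_pmf ?N False (\<lambda>e. bernoulli_pmf (?q e))"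
  have "node_pairs V \<subseteq> Pow V"
    by (auto simp: node_pairs_def)
  then have N: "finite ?N"
    using V finite_subset by blast
  have q: "0 \<le> ?q e" "?q e \<le> 1" for e
    using edge_prob_bounds[OF p] by blast+
  \<comment> \<open>Outcomes are \<open>False\<close> outside the finite set \<open>?N\<close>, so
    the support is finite and every function on it is integrable.\<close>
  have fin: "finite (set_pmf ?M)"
  proof (rule finite_subset)
    show "set_pmf ?M \<subseteq> PiE_dflt ?N False (\<lambda>_. UNIV)"
      using set_Pi_pmf_subset'[OF N, of False "\<lambda>e. bernoulli_pmf (?q e)"]
      by (auto simp: PiE_dflt_def)
  qed (use N in \<open>simp add: finite_PiE_dflt\<close>)
  have component: "measure_pmf.expectation ?M (\<lambda>f. of_bool (f e)) = ?q e" if "e \<in> ?N" for e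
  proof -
    have "measure_pmf.expectation ?M (\<lambda>f. of_bool (f e) :: real) =
        measure_pmf.expectation (map_pmf (\<lambda>f. f e) ?M) of_bool"
      by (rule integral_map_pmf[symmetric])
    also have "\<dots> = ?q e"
      using q that by (simp add: Pi_pmf_component N)
    finally show ?thesis .
  qed
  have count: "edge_count {e \<in> {e \<in> ?N. f e}. X e} = (\<Sum>e\<in>?N. ?w e * of_bool (X e) * of_bool (f e))"
    for f
    unfolding edge_count_def using N
    by (intro sum.mono_neutral_cong_left) auto
  have "expected_edges (sbm_network V L p1 p2) X =
      measure_pmf.expectation ?M (\<lambda>f. \<Sum>e\<in>?N. ?w e * of_bool (X e) * of_bool (f e))"
    by (simp only: expected_edges_def sbm_network_def integral_map_pmf count)
  also have "\<dots> = (\<Sum>e\<in>?N. ?w e * (of_bool (X e) * ?q e))"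
    by (subst Bochner_Integration.integral_sum)
      (auto intro!: integrable_measure_pmf_finite fin sum.cong simp: component)
  also have "\<dots> = (\<Sum>u\<in>V. \<Sum>v\<in>V. of_bool (X {u, v}) * ?q {u, v}) / 2"
    by (rule sum_node_pairs[OF V])
  finally show ?thesis .
qed

text \<open>Deleting edges amounts to counting with a stricter predicate, so the modified network is
  again described by a weight, now zero on pairs internal to \<open>P\<close>.\<close>

lemma expected_edges_remove_edge:
  "expected_edges (map_pmf (remove_edge P) G) X = expected_edges G (\<lambda>e. X e \<and> \<not> internal P e)"
  by (simp add: expected_edges_def integral_map_pmf remove_edge_def conj_ac)

section \<open>Indicator sums over a partition\<close>

lemma partition_on_eqI:
  assumes "partition_on V P" "C \<in> P" "D \<in> P" "x \<in> C" "x \<in> D"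
  shows "C = D"
  using assms by (auto simp: partition_on_def disjoint_def)

lemma sum_of_bool_mem_partition:
  assumes P: "partition_on V P" and fin: "finite P" and u: "u \<in> V"
  shows "(\<Sum>C\<in>P. of_bool (u \<in> C)) = (1 :: real)"
proof -
  obtain C where C: "C \<in> P" "u \<in> C"
    using P u by (auto simp: partition_on_def)
  then have "P \<inter> {D. u \<in> D} = {C}"
    using partition_on_eqI[OF P] by blast
  then show ?thesis
    using fin by (simp add: sum.If_cases of_bool_def)
qed

lemma sum_of_bool_subset_partition:
  assumes P: "partition_on V P" and fin: "finite P" and e: "e \<noteq> {}"
  shows "(\<Sum>C\<in>P. of_bool (e \<subseteq> C)) = (of_bool (internal P e) :: real)"
proof (cases "internal P e")
  case True
  then obtain C where C: "C \<in> P" "e \<subseteq> C"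
    by (auto simp: internal_def)
  then have "P \<inter> {D. e \<subseteq> D} = {C}"
    using partition_on_eqI[OF P] e by blast
  with True fin show ?thesis
    by (simp add: sum.If_cases of_bool_def)
next
  case False
  then show ?thesis
    by (auto simp: internal_def intro!: sum.neutral)
qed

lemma internal_partition_iff:
  assumes "partition_on V P" "C \<in> P" "u \<in> C"
  shows "internal P {u, v} \<longleftrightarrow> v \<in> C"
  using assms(2,3) partition_on_eqI[OF assms(1)] by (auto simp: internal_def)

section \<open>Modularity computed from a weight on pairs\<close>

text \<open>Modularity depends only on expected counts, so \<open>G\<close> is reduced to the weight
  \<open>q\<close>. This treats the networks before and after RemoveEdge alike.\<close>

locale mean_network =
  fixes V :: "'v set" and G :: "'v set set pmf" and q :: "'v set \<Rightarrow> real" and P :: "'v set set"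
  assumes finite_nodes: "finite V"
    and partition: "partition_on V P"
    and weight_nonneg: "0 \<le> q e"
    and mean: "expected_edges G X = (\<Sum>u\<in>V. \<Sum>v\<in>V. of_bool (X {u, v}) * q {u, v}) / 2"
begin

lemma finite_communities: "finite P"
  using finite_nodes partition by (rule finite_elements)

text \<open>Double counting: each of the two endpoints of an edge lies in exactly one
  community.\<close>

lemma sum_community_degree: "(\<Sum>C\<in>P. community_degree G C) = 2 * edges_total G"
proof -
  have "community_degree G C = (\<Sum>u\<in>V. \<Sum>v\<in>V. (of_bool (u \<in> C) + of_bool (v \<in> C)) * q {u, v}) / 2" for C
  proof -
    have "community_degree G C = (\<Sum>u\<in>V. \<Sum>v\<in>V. 2 * (of_bool ({u, v} \<subseteq> C) * q {u, v}) +
        of_bool ({u, v} \<inter> C \<noteq> {} \<and> \<not> {u, v} \<subseteq> C) * q {u, v}) / 2"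
      by (simp only: community_degree_def edges_in_def edges_out_def mean sum.distrib
          sum_distrib_left[symmetric] add_divide_distrib times_divide_eq_right)
    also have "\<dots> = (\<Sum>u\<in>V. \<Sum>v\<in>V. (of_bool (u \<in> C) + of_bool (v \<in> C)) * q {u, v}) / 2"
      \<comment> \<open>Twice the indicator of both endpoints in \<open>C\<close>, plus that of
        exactly one, is the number of endpoints in \<open>C\<close>.\<close>
      by (intro arg_cong2[where f = "(/)"] sum.cong refl) (auto simp: of_bool_def)
    finally show ?thesis .
  qed
  then have "(\<Sum>C\<in>P. community_degree G C) =
      (\<Sum>C\<in>P. \<Sum>u\<in>V. \<Sum>v\<in>V. (of_bool (u \<in> C) + of_bool (v \<in> C)) * q {u, v}) / 2"
    by (simp add: sum_divide_distrib)
  also have "\<dots> = (\<Sum>u\<in>V. \<Sum>v\<in>V. \<Sum>C\<in>P. (of_bool (u \<in> C) + of_bool (v \<in> C)) * q {u, v}) / 2"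
    by (subst sum.swap, subst (2) sum.swap) simp
  also have "\<dots> = (\<Sum>u\<in>V. \<Sum>v\<in>V. 2 * q {u, v}) / 2"
    by (simp add: sum_distrib_right[symmetric] sum.distrib finite_communities
        sum_of_bool_mem_partition[OF partition] del: sum_of_bool_eq cong: sum.cong)
  also have "\<dots> = 2 * edges_total G"
    by (simp add: edges_total_def mean sum_distrib_left[symmetric])
  finally show ?thesis .
qed

lemma sum_edges_in: "(\<Sum>C\<in>P. edges_in G C) = expected_edges G (internal P)"
proof -
  have "(\<Sum>C\<in>P. edges_in G C) = (\<Sum>C\<in>P. \<Sum>u\<in>V. \<Sum>v\<in>V. of_bool ({u, v} \<subseteq> C) * q {u, v}) / 2"
    by (simp only: edges_in_def mean sum_divide_distrib)
  also have "\<dots> = (\<Sum>u\<in>V. \<Sum>v\<in>V. \<Sum>C\<in>P. of_bool ({u, v} \<subseteq> C) * q {u, v}) / 2"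
    by (subst sum.swap, subst (2) sum.swap) simp
  also have "\<dots> = expected_edges G (internal P)"
    by (simp only: sum_distrib_right[symmetric] mean finite_communities
        sum_of_bool_subset_partition[OF partition] insert_not_empty not_False_eq_True)
  finally show ?thesis .
qed

text \<open>The pair \<open>{u, v}\<close> has positive weight but is not internal, which makes the
  internal fraction strictly less than 1; the Cauchy-Schwarz bound supplies the term
  \<open>1 / card P\<close>.\<close>

lemma modularity_less:
  assumes uv: "u \<in> V" "v \<in> V" "\<not> internal P {u, v}" "0 < q {u, v}"
  shows "modularity G P < 1 - 1 / card P"
proof -
  let ?e = "edges_total G"
  have m: "0 < card P"
    using uv partition finite_communities by (auto simp: partition_on_def card_gt_0_iff)
  have "expected_edges G (internal P) < ?e"
  proof -
    have "(\<Sum>x\<in>V. \<Sum>y\<in>V. of_bool (internal P {x, y}) * q {x, y}) < (\<Sum>x\<in>V. \<Sum>y\<in>V. q {x, y})"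
      unfolding sum.cartesian_product using uv finite_nodes weight_nonneg
      by (intro sum_strict_mono_ex1) (auto intro!: bexI[of _ "(u, v)"])
    then show ?thesis
      by (simp add: edges_total_def mean)
  qed
  moreover have "0 \<le> expected_edges G (internal P)"
    by (auto simp: mean intro!: sum_nonneg weight_nonneg)
  \<comment> \<open>A total strictly above a nonnegative count is positive, so division by it is
    safe.\<close>
  ultimately have e: "0 < ?e" and ratio: "expected_edges G (internal P) / ?e < 1"
    by auto
  have "1 = (\<Sum>C\<in>P. community_degree G C / (2 * ?e))\<^sup>2"
    using e by (simp add: sum_divide_distrib[symmetric] sum_community_degree)
  also have "\<dots> \<le> (\<Sum>C\<in>P. (community_degree G C / (2 * ?e))\<^sup>2) * card P"
    by (rule sum_squared_le_sum_of_squares)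
  finally have "1 / card P \<le> (\<Sum>C\<in>P. (community_degree G C / (2 * ?e))\<^sup>2)"
    using m by (simp add: field_simps)
  moreover have "modularity G P =
      expected_edges G (internal P) / ?e - (\<Sum>C\<in>P. (community_degree G C / (2 * ?e))\<^sup>2)"
    by (simp add: modularity_def sum_subtractf sum_divide_distrib[symmetric] sum_edges_in)
  ultimately show ?thesis
    using ratio by linarith
qed

text \<open>Without edges between communities every degree is \<open>2 * a\<close> and the total is
  \<open>card P * a\<close>, so each summand equals
  \<open>1 / card P - (1 / card P)\<^sup>2\<close>.\<close>

lemma modularity_eq:
  assumes nonempty: "P \<noteq> {}"
    and zero: "\<And>u v. u \<in> V \<Longrightarrow> v \<in> V \<Longrightarrow> \<not> internal P {u, v} \<Longrightarrow> q {u, v} = 0"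
    and inside: "\<And>C. C \<in> P \<Longrightarrow> edges_in G C = a" and a: "0 < a"
  shows "modularity G P = 1 - 1 / card P"
proof -
  have m: "0 < card P"
    using nonempty finite_communities by (simp add: card_gt_0_iff)
  have deg: "community_degree G C = 2 * a" if "C \<in> P" for C
  proof -
    have "of_bool ({u, v} \<inter> C \<noteq> {} \<and> \<not> {u, v} \<subseteq> C) * q {u, v} = 0"
      if "u \<in> V" "v \<in> V" for u v
    proof (cases "{u, v} \<inter> C \<noteq> {} \<and> \<not> {u, v} \<subseteq> C")
      case True
      \<comment> \<open>Exactly one endpoint lies in \<open>C\<close>. It may be either one, hence
        the two instances.\<close>
      then have "\<not> internal P {u, v}"
        using \<open>C \<in> P\<close> internal_partition_iff[OF partition \<open>C \<in> P\<close>, of u v]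
          internal_partition_iff[OF partition \<open>C \<in> P\<close>, of v u] by (auto simp: insert_commute)
      with that show ?thesis
        using zero by simp
    qed simp
    then have "edges_out G C = 0"
      by (simp only: edges_out_def mean sum.neutral_const div_0 cong: sum.cong)
    with inside[OF that] show ?thesis
      by (simp add: community_degree_def)
  qed
  have "edges_total G = card P * a"
    using sum_community_degree by (simp add: deg)
  then show ?thesis
    using m a by (simp add: modularity_def deg inside power2_eq_square field_simps)
qed

end

section \<open>Comparison before and after RemoveEdge\<close>

text \<open>The layers are abstracted to \<open>P\<close>, whose modularity is measured, and
  \<open>Q\<close>, whose edges are removed, so that one argument serves both choices of
  \<open>l\<close> and \<open>k\<close>.\<close>

lemma modularity_remove_edge_gt:
  fixes V :: "'v set" and q :: "'v set \<Rightarrow> real"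
  assumes network: "mean_network V G q P"
    and Q: "partition_on V Q" and "V \<noteq> {}"
    and cardP: "\<And>C. C \<in> P \<Longrightarrow> card C = s" and cardQ: "\<And>D. D \<in> Q \<Longrightarrow> card D = t"
    and cardPQ: "\<And>C D. C \<in> P \<Longrightarrow> D \<in> Q \<Longrightarrow> card (C \<inter> D) = r"
    and "r < s" "r < t"
    and only_P: "\<And>e. internal P e \<Longrightarrow> \<not> internal Q e \<Longrightarrow> q e = p" and "0 < p"
    and only_Q: "\<And>e. internal Q e \<Longrightarrow> \<not> internal P e \<Longrightarrow> 0 < q e"
    and neither: "\<And>e. \<not> internal P e \<Longrightarrow> \<not> internal Q e \<Longrightarrow> q e = 0"
  shows "modularity G P < modularity (map_pmf (remove_edge Q) G) P"
proof -
  interpret mean_network V G q P by fact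
  let ?G = "map_pmf (remove_edge Q) G" and ?q = "\<lambda>e. of_bool (\<not> internal Q e) * q e"
  interpret removed: mean_network V ?G ?q P
  proof
    show "expected_edges ?G X = (\<Sum>u\<in>V. \<Sum>v\<in>V. of_bool (X {u, v}) * ?q {u, v}) / 2" for X
      by (simp only: expected_edges_remove_edge mean of_bool_conj mult.assoc)
  qed (simp_all only: finite_nodes partition weight_nonneg mult_nonneg_nonneg zero_less_eq_of_bool)
  obtain u where u: "u \<in> V"
    using \<open>V \<noteq> {}\<close> by blast
  then obtain C D where CD: "C \<in> P" "u \<in> C" "D \<in> Q" "u \<in> D"
    using partition_onD1[OF partition] partition_onD1[OF Q] by blast
  have sub: "C \<subseteq> V" if "C \<in> P" for C
    using that partition by (auto simp: partition_on_def)
  \<comment> \<open>Otherwise \<open>C \<inter> D = D\<close> would have \<open>t > r\<close>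
    elements. A node \<open>v\<close> of \<open>D\<close> outside \<open>C\<close> then forms with
    \<open>u\<close> a pair internal to \<open>Q\<close> only.\<close>
  have "\<not> D \<subseteq> C"
    using cardQ[of D] cardPQ[of C D] CD \<open>r < t\<close> by (auto simp: Int_absorb1)
  then obtain v where v: "v \<in> D" "v \<notin> C"
    by blast
  with CD Q have "v \<in> V"
    by (auto simp: partition_on_def)
  moreover have "\<not> internal P {u, v}" "internal Q {u, v}"
    using CD v partition Q by (simp_all add: internal_partition_iff)
  ultimately have before: "modularity G P < 1 - 1 / card P"
    using u only_Q by (intro modularity_less[of u v]) auto
  \<comment> \<open>Each of the \<open>s\<close> nodes of \<open>C\<close> keeps weight
    \<open>p\<close> exactly towards the \<open>s - r\<close> nodes of \<open>C\<close> outside its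
    own \<open>Q\<close>-community; halving accounts for ordered pairs.\<close>
  have inside: "edges_in ?G C = s * ((s - r) * p) / 2" if C: "C \<in> P" for C
  proof -
    have fC: "finite C"
      using sub[OF C] finite_nodes finite_subset by blast
    have row: "(\<Sum>y\<in>C. ?q {x, y}) = (s - r) * p" if x: "x \<in> C" for x
    proof -
      obtain D where D: "D \<in> Q" "x \<in> D"
        using Q x sub[OF C] by (auto simp: partition_on_def)
      have "(\<Sum>y\<in>C. ?q {x, y}) = (\<Sum>y\<in>C - D. p)"
        using fC only_P internal_partition_iff[OF Q D] internal_partition_iff[OF partition C x]
        by (intro sum.mono_neutral_cong_right) auto
      also have "card (C - D) = s - r"
        using fC cardP[OF C] cardPQ[OF C D(1)] by (simp add: card_Diff_subset_Int)
      then have "(\<Sum>y\<in>C - D. p) = (s - r) * p"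
        by simp
      finally show ?thesis .
    qed
    have "(\<Sum>x\<in>V. \<Sum>y\<in>V. of_bool ({x, y} \<subseteq> C) * ?q {x, y}) = (\<Sum>x\<in>C. \<Sum>y\<in>C. ?q {x, y})"
      unfolding sum.cartesian_product using sub[OF C] finite_nodes
      by (intro sum.mono_neutral_cong_right) auto
    also have "\<dots> = s * ((s - r) * p)"
      by (simp only: row cardP[OF C] sum_constant cong: sum.cong)
    finally show ?thesis
      by (simp only: edges_in_def removed.mean)
  qed
  have "modularity ?G P = 1 - 1 / card P"
    using CD(1) inside neither \<open>r < s\<close> \<open>0 < p\<close>
    by (intro removed.modularity_eq[where a = "s * ((s - r) * p) / 2"]) auto
  with before show ?thesis
    by simp
qed

theorem theorem1:
  fixes V :: "'v set" and L :: "nat \<Rightarrow> 'v set set"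
    and n n1 n2 l k :: nat and p1 p2 :: real
  assumes "two_layer_sbm V L n n1 n2 p1 p2"
    and "{l, k} = {1, 2}"
  shows "modularity (map_pmf (remove_edge (L k)) (sbm_network V L p1 p2)) (L l)
           > modularity (sbm_network V L p1 p2) (L l)"
proof -
  interpret two_layer_sbm V L n n1 n2 p1 p2 by fact
  let ?q = "edge_prob L p1 p2" and ?r = "n div (n1 * n2)"
  have V: "V \<noteq> {}"
    using card_V n_pos by auto
  have q: "0 \<le> ?q e" for e
    using p1 p2 by (intro edge_prob_bounds) auto
  have net: "mean_network V (sbm_network V L p1 p2) ?q (L i)" if "partition_on V (L i)" for i
    using that finite_V p1 p2 q by unfold_locales (auto simp only: intro!: expected_edges_sbm_network)
  have intersection_size': "card (D \<inter> C) = ?r" if "D \<in> L 2" "C \<in> L 1" for C D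
    using intersection_size[OF that(2,1)] by (simp add: Int_commute)
  obtain r where r: "n = n1 * n2 * r"
    using divides by (elim dvdE)
  \<comment> \<open>The community sizes are \<open>n2 * r\<close> and \<open>n1 * r\<close>, the
    intersection size is \<open>r\<close>, and \<open>r > 0\<close> because
    \<open>n > 0\<close>.\<close>
  have sizes: "?r < n div n1" "?r < n div n2"
    using n_pos n1_ge_3 n2_ge_3 by (simp_all add: r)
  from assms(2) consider "l = 1" "k = 2" | "l = 2" "k = 1"
    by (auto simp: doubleton_eq_iff)
  then show ?thesis
  proof cases
    case 1
    show ?thesis
      unfolding 1 using sizes p1 p2
      by (intro modularity_remove_edge_gt[OF net[OF partition1] partition2 V, of
            "n div n1" "n div n2" ?r p1])
        (auto simp: community_size1 community_size2 intersection_size edge_prob_def)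
  next
    case 2
    show ?thesis
      unfolding 2 using sizes p1 p2
      by (intro modularity_remove_edge_gt[OF net[OF partition2] partition1 V, of
            "n div n2" "n div n1" ?r p2])
        (auto simp: community_size1 community_size2 intersection_size' edge_prob_def)
  qed
qed

end
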